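(* 1. (Hermite interpolation) Let $\boldsymbol{\omega}^*\in\Omega$, let $(\lambda_i,\mathbf{x}_i)$ be a simple eigenpair (that is, $\lambda_i$ is a simple eigenvalue) of the pencil $(\mathbf{A},\mathbf{B})$ at $\boldsymbol{\omega}^*$, and let $\mathcal{V}\subset\mathbb{R}^n$ be a subspace spanned by the columns of a matrix $\mathbf{V}\in\mathbb{R}^{n\times m}$ with orthonormal columns. All quantities in this part are evaluated at $\boldsymbol{\omega}^*$. If $\mathbf{x}_i\in\mathcal{V}$, then - $\left(\lambda_i^{\mathcal{V}},\mathbf{x}_i^{\mathcal{V}}\right)=\left(\lambda_i,\mathbf{V}^T\mathbf{x}_i\right)$ is an eigenpair of the reduced pencil $\left(\mathbf{V}^T\mathbf{A}\mathbf{V},\mathbf{V}^T\mathbf{B}\mathbf{V}\right)$; - $\displaystyle\frac{\partial\lambda_i^{\mathcal{V}}}{\partial\omega_j}=\frac{\partial\lambda_i}{\partial\omega_j}$ for $j=1,\dots,d$. If $\mathbf{x}_i\in\mathcal{V}$ and $\dfrac{\partial\mathbf{x}_i}{\partial\omega_j}\in\mathcal{V}$, then $$\frac{\partial^2\lambda_i^{\mathcal{V}}}{\partial\omega_j\,\partial\omega_k}=\frac{\partial^2\lambda_i}{\partial\omega_j\,\partial\omega_k},\qquad k=1,\dots,d.$$ 2. If $\mathcal{V}_1\subset\mathcal{V}_2$ are subspaces of $\mathbb{R}^n$, then $$\lambda_1(\boldsymbol{\omega})\le\lambda_1^{\mathcal{V}_2}(\boldsymbol{\omega})\le\lambda_1^{\mathcal{V}_1}(\boldsymbol{\omega})\qquad\text{for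 all }\boldsymbol{\omega}\in\Omega,$$ where $\lambda_1$ and $\lambda_1^{\mathcal{V}}$ denote the minimal eigenvalues of the original pencil and of the reduced pencil on $\mathcal{V}$, respectively. That is, if the subspace is extended, the estimate of the minimal eigenvalue is at least as good.
   Context: $\Omega\subset\mathbb{R}^d$ is compact, and $\mathbf{A}(\boldsymbol{\omega}),\mathbf{B}(\boldsymbol{\omega})\in\mathbb{R}^{n\times n}$ are symmetric matrices depending analytically on the parameter $\boldsymbol{\omega}=(\omega_1,\dots,\omega_d)$ for all $\boldsymbol{\omega}\in\Omega$, with $\mathbf{B}(\boldsymbol{\omega})$ positive definite. An eigenpair of a pencil $(\mathbf{A},\mathbf{B})$ is a pair $(\lambda,\mathbf{x})$ with $\mathbf{A}\mathbf{x}=\lambda\mathbf{B}\mathbf{x}$, $\mathbf{x}\neq\mathbf{0}$; the eigenvalues are real and ordered $\lambda_1\le\dots\le\lambda_n$, and eigenvectors are normalised by $\mathbf{x}^T\mathbf{B}\mathbf{x}=1$. For a fixed (parameter-independent) subspace $\mathcal{V}$ of dimension $m$, spanned by the columns of $\mathbf{V}\in\mathbb{R}^{n\times m}$ with $\mathbf{V}^T\mathbf{V}=\mathbf{I}_m$, the reduced eigenvalue problem on $\mathcal{V}$ is the pencil $\left(\mathbf{V}^T\mathbf{A}(\boldsymbol{\omega})\mathbf{V},\mathbf{V}^T\mathbf{B}(\boldsymbol{\omega})\mathbf{V}\right)$, whose eigenpairs are denoted $\left(\lambda_i^{\mathcal{V}}(\boldsymbol{\omega}),\mathbf{x}_i^{\mathcal{V}}(\boldsymbol{\omega})\right)$.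 If $\lambda_i^*$ is a simple eigenvalue at $\boldsymbol{\omega}^*$ with normalised eigenvector $\mathbf{x}_i^*$, there are a neighbourhood $\Omega^*$ of $\boldsymbol{\omega}^*$ and smooth functions $\lambda_i:\Omega^*\to\mathbb{R}$, $\mathbf{x}_i:\Omega^*\to\mathbb{R}^n$ with $\mathbf{A}(\boldsymbol{\omega})\mathbf{x}_i(\boldsymbol{\omega})=\lambda_i(\boldsymbol{\omega})\mathbf{B}(\boldsymbol{\omega})\mathbf{x}_i(\boldsymbol{\omega})$ and $\mathbf{x}_i(\boldsymbol{\omega})^T\mathbf{B}(\boldsymbol{\omega})\mathbf{x}_i(\boldsymbol{\omega})=1$ on $\Omega^*$, and $\lambda_i(\boldsymbol{\omega}^* )=\lambda_i^*$, $\mathbf{x}_i(\boldsymbol{\omega}^* )=\mathbf{x}_i^*$. Partial derivatives of eigenvalues and eigenvectors always refer to such smooth normalised eigenpair functions. The same convention applies to the reduced pencil: derivatives of $\lambda_i^{\mathcal{V}}$ at $\boldsymbol{\omega}^*$ refer to the smooth normalised eigenpair functions of the reduced pencil passing through the eigenpair $(\lambda_i,\mathbf{V}^T\mathbf{x}_i)$ at $\boldsymbol{\omega}^*$. *)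

theory Defs
  imports "HOL-Analysis.Analysis" "HOL-Computational_Algebra.Polynomial"
begin

text \<open>Real-analyticity in several variables: near \<open>a\<close> the function is the (unconditional) sum of a
  power series in \<open>w - a\<close>, indexed by multi-indices \<open>\<alpha>\<close>. The value of \<open>f\<close> in a full
  neighbourhood of \<open>a\<close> is involved, so on a boundary point of a compact set this means
  analyticity beyond the set.\<close>

definition real_analytic_at ::
    "(real ^ 'd \<Rightarrow> 'b::real_normed_vector) \<Rightarrow> real ^ 'd \<Rightarrow> bool" where
  "real_analytic_at f a \<longleftrightarrow>
    (\<exists>r>0. \<exists>c :: ('d \<Rightarrow> nat) \<Rightarrow> 'b. \<forall>w\<in>ball a r.
       ((\<lambda>\<alpha>. (\<Prod>i\<in>UNIV. (w $ i - a $ i) ^ \<alpha> i) *\<^sub>R c \<alpha>) has_sum f w) UNIV)"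

definition real_analytic_on ::
    "(real ^ 'd \<Rightarrow> 'b::real_normed_vector) \<Rightarrow> (real ^ 'd) set \<Rightarrow> bool" where
  "real_analytic_on f S \<longleftrightarrow> (\<forall>a\<in>S. real_analytic_at f a)"

definition partial_deriv ::
    "'d \<Rightarrow> (real ^ 'd \<Rightarrow> 'b::real_normed_vector) \<Rightarrow> real ^ 'd \<Rightarrow> 'b" where
  "partial_deriv j f w = vector_derivative (\<lambda>t. f (w + t *\<^sub>R axis j 1)) (at 0)"

text \<open>The next two notions are meant for open sets \<open>S\<close>.\<close>

primrec Ck_on :: "nat \<Rightarrow> (real ^ 'd \<Rightarrow> 'b::real_normed_vector) \<Rightarrow> (real ^ 'd) set \<Rightarrow> bool" where
  "Ck_on 0 f S \<longleftrightarrow> continuous_on S f"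
| "Ck_on (Suc k) f S \<longleftrightarrow> f differentiable_on S \<and> (\<forall>j. Ck_on k (partial_deriv j f) S)"

definition smooth_on :: "(real ^ 'd \<Rightarrow> 'b::real_normed_vector) \<Rightarrow> (real ^ 'd) set \<Rightarrow> bool" where
  "smooth_on f S \<longleftrightarrow> (\<forall>k. Ck_on k f S)"

definition symmetric_mat :: "real ^ 'n ^ 'n \<Rightarrow> bool" where
  "symmetric_mat M \<longleftrightarrow> transpose M = M"

definition pos_def_mat :: "real ^ 'n ^ 'n \<Rightarrow> bool" where
  "pos_def_mat M \<longleftrightarrow> (\<forall>x. x \<noteq> 0 \<longrightarrow> x \<bullet> (M *v x) > 0)"

definition eigenpair :: "real ^ 'n ^ 'n \<Rightarrow> real ^ 'n ^ 'n \<Rightarrow> real \<Rightarrow> real ^ 'n \<Rightarrow> bool" where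
  "eigenpair A B l x \<longleftrightarrow> A *v x = l *\<^sub>R (B *v x) \<and> x \<noteq> 0"

definition normalised_eigenpair ::
    "real ^ 'n ^ 'n \<Rightarrow> real ^ 'n ^ 'n \<Rightarrow> real \<Rightarrow> real ^ 'n \<Rightarrow> bool" where
  "normalised_eigenpair A B l x \<longleftrightarrow> eigenpair A B l x \<and> x \<bullet> (B *v x) = 1"

text \<open>The polynomial \<open>det (A - z B)\<close> in \<open>z\<close>; it is nonzero if \<open>B\<close> is positive definite.\<close>

definition pencil_charpoly :: "real ^ 'n ^ 'n \<Rightarrow> real ^ 'n ^ 'n \<Rightarrow> real poly" where
  "pencil_charpoly A B = det (\<chi> i j. [: A $ i $ j, - (B $ i $ j) :])"

definition simple_eigenvalue :: "real ^ 'n ^ 'n \<Rightarrow> real ^ 'n ^ 'n \<Rightarrow> real \<Rightarrow> bool" where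
  "simple_eigenvalue A B l \<longleftrightarrow> order l (pencil_charpoly A B) = 1"

text \<open>For symmetric \<open>A\<close> and symmetric positive definite \<open>B\<close> the set below is finite and nonempty.\<close>

definition min_eigenvalue :: "real ^ 'n ^ 'n \<Rightarrow> real ^ 'n ^ 'n \<Rightarrow> real" where
  "min_eigenvalue A B = Min {l. \<exists>x. eigenpair A B l x}"

definition reduced_mat :: "real ^ 'm ^ 'n \<Rightarrow> real ^ 'n ^ 'n \<Rightarrow> real ^ 'm ^ 'm" where
  "reduced_mat V M = transpose V ** M ** V"

definition orthonormal_basis_of :: "real ^ 'm ^ 'n \<Rightarrow> (real ^ 'n) set \<Rightarrow> bool" where
  "orthonormal_basis_of V S \<longleftrightarrow> transpose V ** V = mat 1 \<and> span (columns V) = S"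

text \<open>\<open>(l, x)\<close> are smooth normalised eigenpair functions of the pencil \<open>(A, B)\<close> on some open
  neighbourhood of \<open>w0\<close>, passing through \<open>(l0, x0)\<close> at \<open>w0\<close>. They exist if \<open>l0\<close> is a simple
  eigenvalue at \<open>w0\<close>. A simple eigenvalue of a pencil can be multiple for a reduced pencil,
  and such functions need not exist or be unique there, so statements on derivatives of reduced
  eigenvalues are made for all smooth normalised eigenpair functions through the given eigenpair.\<close>

definition smooth_eigenpair_at ::
    "(real ^ 'd \<Rightarrow> real ^ 'n ^ 'n) \<Rightarrow> (real ^ 'd \<Rightarrow> real ^ 'n ^ 'n) \<Rightarrow> real ^ 'd \<Rightarrow> real \<Rightarrow> real ^ 'n \<Rightarrow>
     (real ^ 'd \<Rightarrow> real) \<Rightarrow> (real ^ 'd \<Rightarrow> real ^ 'n) \<Rightarrow> bool" where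
  "smooth_eigenpair_at A B w0 l0 x0 l x \<longleftrightarrow>
    (\<exists>W. open W \<and> w0 \<in> W \<and> smooth_on l W \<and> smooth_on x W \<and>
         (\<forall>w\<in>W. normalised_eigenpair (A w) (B w) (l w) (x w)) \<and>
         l w0 = l0 \<and> x w0 = x0)"

end

(* If x0 = V y0 lies in the subspace, the first order perturbation formula
   l_k = x^T (A_k - l B_k) x gives the same value for both pencils. Differentiating it once more,
   the second derivatives can differ only by 2 (V u)^T (A_k - l B_k) x0, where u is the difference
   of the coordinates of the two eigenvector derivatives in direction j. Both derivatives solve the
   linearised equation, so u lies in the kernel of V^T (A - l B) V, and normalisation makes V u
   B-orthogonal to x0; the linearised equation in direction k then makes the term vanish, even if
   the eigenvalue is multiple for the reduced pencil. The second part compares minima of Rayleigh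
   quotients over nested subspaces. *)

theory Submission
  imports Defs
begin

section \<open>Coordinate derivatives of real-analytic functions\<close>

text \<open>For \<open>n > 0\<close> the left side is one term of the binomial expansion of the
  right, whose terms are all nonnegative. It bounds a differentiated power by the power at a larger
  point, at the cost of a factor \<open>1 / \<delta>\<close>.\<close>

lemma power_derivative_bound:
  fixes x \<delta> :: real
  assumes "0 \<le> x" "0 \<le> \<delta>"
  shows "real n * x ^ (n - 1) * \<delta> \<le> (x + \<delta>) ^ n"
proof (induction n)
  case (Suc n)
  \<comment> \<open>At \<open>n = 0\<close> the truncated \<open>n - 1\<close> is harmless because
    of the factor \<open>real n\<close>.\<close>
  have "real n * x ^ n * \<delta> = (real n * x ^ (n - 1) * \<delta>) * x"
    by (cases n) auto
  also have "(real n * x ^ (n - 1) * \<delta>) * x \<le> (x + \<delta>) ^ n * x"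
    by (rule mult_right_mono[OF Suc]) (use assms in auto)
  finally have "real n * x ^ n * \<delta> \<le> (x + \<delta>) ^ n * x" .
  moreover have "x ^ n * \<delta> \<le> (x + \<delta>) ^ n * \<delta>"
    using assms by (intro mult_right_mono power_mono) auto
  ultimately show ?case
    by (simp add: algebra_simps)
qed auto

text \<open>Absolute convergence at a point farther out majorises the differentiated terms uniformly
  near \<open>w\<close>. Enumerating the countably many multi-indices then reduces the claim to
  termwise differentiation of an ordinary series.\<close>

lemma multi_series_derivative:
  fixes c :: "('d::finite \<Rightarrow> nat) \<Rightarrow> real" and f :: "real ^ 'd \<Rightarrow> real"
  assumes f: "\<And>w. w \<in> ball a r \<Longrightarrow>
      ((\<lambda>\<alpha>. (\<Prod>i\<in>UNIV. (w $ i - a $ i) ^ \<alpha> i) * c \<alpha>) has_sum f w) UNIV"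
    and w: "w \<in> ball a r"
  shows "\<exists>g. ((\<lambda>t. f (w + t *\<^sub>R axis k 1)) has_real_derivative g) (at 0) \<and>
     ((\<lambda>\<alpha>. real (\<alpha> k) * (w $ k - a $ k) ^ (\<alpha> k - 1) *
        ((\<Prod>i\<in>UNIV-{k}. (w $ i - a $ i) ^ \<alpha> i) * c \<alpha>)) has_sum g) UNIV"
proof -
  \<comment> \<open>Two steps of length \<open>\<delta>\<close> fit between \<open>w\<close> and the
    edge of the ball: one for the range of \<open>t\<close>, one to be spent in
    \<open>power_derivative_bound\<close>.\<close>
  define \<delta> where "\<delta> = (r - norm (w - a)) / 3"
  have \<delta>: "\<delta> > 0" "norm (w - a) + 2 * \<delta> < r"
    using w by (auto simp: \<delta>_def dist_norm norm_minus_commute field_simps)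
  \<comment> \<open>Absolute values make the coordinates of \<open>p - a\<close> nonnegative, so
    that monomials at \<open>p\<close> dominate those near \<open>w\<close>. They preserve the norm,
    which keeps \<open>p\<close> in the ball.\<close>
  define u where "u = (\<chi> i. \<bar>w $ i - a $ i\<bar>)"
  define p where "p = a + (u + (2 * \<delta>) *\<^sub>R axis k 1)"
  \<comment> \<open>\<open>K\<close> collects the factors that are constant along the line,
    \<open>T\<close> and \<open>T'\<close> are the terms and their derivatives in \<open>t\<close>,
    and \<open>M\<close> is the majorant.\<close>
  define K where "K = (\<lambda>\<alpha>. (\<Prod>i\<in>UNIV-{k}. (w $ i - a $ i) ^ \<alpha> i) * c \<alpha>)"
  define T where "T = (\<lambda>t \<alpha>. (w $ k - a $ k + t) ^ \<alpha> k * K \<alpha>)"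
  define T' where "T' = (\<lambda>t \<alpha>. real (\<alpha> k) * (w $ k - a $ k + t) ^ (\<alpha> k - 1) * K \<alpha>)"
  define M where "M = (\<lambda>\<alpha>. (1 / \<delta>) * \<bar>(\<Prod>i\<in>UNIV. (p $ i - a $ i) ^ \<alpha> i) * c \<alpha>\<bar>)"
  have "norm u = norm (w - a)"
    by (simp add: u_def norm_vec_def)
  then have "norm (u + (2 * \<delta>) *\<^sub>R axis k 1) < r"
    using norm_triangle_ineq[of u "(2 * \<delta>) *\<^sub>R axis k 1"] \<delta> by simp
  then have p: "p \<in> ball a r"
    using norm_minus_cancel[of "u + (2 * \<delta>) *\<^sub>R axis k 1"] by (simp add: p_def dist_norm)
  have M_summable: "M summable_on UNIV"
  proof -
    have "(\<lambda>\<alpha>. (\<Prod>i\<in>UNIV. (p $ i - a $ i) ^ \<alpha> i) * c \<alpha>) summable_on UNIV"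
      using f[OF p] has_sum_imp_summable by blast
    \<comment> \<open>For real families, unconditional and absolute summability coincide.\<close>
    then have "(\<lambda>\<alpha>. \<bar>(\<Prod>i\<in>UNIV. (p $ i - a $ i) ^ \<alpha> i) * c \<alpha>\<bar>) summable_on UNIV"
      by (drule_tac summable_on_iff_abs_summable_on_real[THEN iffD1]) (simp only: real_norm_def)
    then show ?thesis
      unfolding M_def by (rule summable_on_cmult_right)
  qed
  have bound: "\<bar>T' t \<alpha>\<bar> \<le> M \<alpha>" if "t \<in> {-\<delta><..<\<delta>}" for t \<alpha>
  proof -
    have prod: "(\<Prod>i\<in>UNIV. (p $ i - a $ i) ^ \<alpha> i) =
        (u $ k + 2 * \<delta>) ^ \<alpha> k * (\<Prod>i\<in>UNIV-{k}. (u $ i) ^ \<alpha> i)"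
      by (subst prod.remove[of _ k]) (auto simp: p_def axis_def intro!: prod.cong)
    have K: "\<bar>K \<alpha>\<bar> = (\<Prod>i\<in>UNIV-{k}. (u $ i) ^ \<alpha> i) * \<bar>c \<alpha>\<bar>"
      by (simp add: K_def u_def abs_mult abs_prod power_abs)
    have u0: "0 \<le> u $ i" for i by (simp add: u_def)
    have M: "M \<alpha> = (1 / \<delta>) * ((u $ k + 2 * \<delta>) ^ \<alpha> k * \<bar>K \<alpha>\<bar>)"
      using \<delta>(1) u0 unfolding M_def prod abs_mult K by (simp add: abs_prod prod_nonneg)
    have "\<bar>w $ k - a $ k + t\<bar> \<le> u $ k + \<delta>"
      using that by (simp add: u_def) linarith
    then have "real (\<alpha> k) * \<bar>w $ k - a $ k + t\<bar> ^ (\<alpha> k - 1) \<le> real (\<alpha> k) * (u $ k + \<delta>) ^ (\<alpha> k - 1)"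
      by (intro mult_left_mono power_mono) auto
    also have "\<dots> \<le> (1 / \<delta>) * (u $ k + 2 * \<delta>) ^ \<alpha> k"
      using power_derivative_bound[of "u $ k + \<delta>" \<delta> "\<alpha> k"] u0[of k] \<delta>(1)
      by (simp add: field_simps)
    finally show ?thesis
      unfolding M T'_def abs_mult power_abs mult.assoc[symmetric]
      by (intro mult_right_mono) auto
  qed
  define e where "e = from_nat_into (UNIV :: ('d \<Rightarrow> nat) set)"
  have "infinite (UNIV :: ('d \<Rightarrow> nat) set)"
    using finite_fun_UNIVD2 by auto
  then have e: "bij_betw e UNIV UNIV"
    unfolding e_def by (intro bij_betw_from_nat_into) auto
  have sums_e: "(\<lambda>n. h (e n)) sums s" if "(h has_sum s) UNIV" for h :: "('d \<Rightarrow> nat) \<Rightarrow> real" and s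
    using that has_sum_reindex_bij_betw[OF e, of h s] has_sum_imp_sums by blast
  have T_sum: "(T t has_sum f (w + t *\<^sub>R axis k 1)) UNIV" if "t \<in> {-\<delta><..<\<delta>}" for t
  proof -
    have "norm (w - a + t *\<^sub>R axis k 1) < r"
      using norm_triangle_ineq[of "w - a" "t *\<^sub>R axis k 1"] \<delta> that by simp linarith
    then have "w + t *\<^sub>R axis k 1 \<in> ball a r"
      by (simp add: dist_norm norm_minus_commute algebra_simps)
    moreover have "T t = (\<lambda>\<alpha>. (\<Prod>i\<in>UNIV. ((w + t *\<^sub>R axis k 1) $ i - a $ i) ^ \<alpha> i) * c \<alpha>)"
    proof
      fix \<alpha>
      show "T t \<alpha> = (\<Prod>i\<in>UNIV. ((w + t *\<^sub>R axis k 1) $ i - a $ i) ^ \<alpha> i) * c \<alpha>"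
        by (subst prod.remove[of _ k]) (auto simp: T_def K_def axis_def algebra_simps intro!: prod.cong)
    qed
    ultimately show ?thesis using f[of "w + t *\<^sub>R axis k 1"] by (simp only:)
  qed
  have M_e: "summable (\<lambda>n. M (e n))"
    using sums_e[OF has_sum_infsum[OF M_summable]] sums_summable by blast
  have deriv: "((\<lambda>t. \<Sum>n. T t (e n)) has_field_derivative (\<Sum>n. T' 0 (e n))) (at 0)"
  proof (rule has_field_derivative_series'(2))
    show "uniformly_convergent_on {-\<delta><..<\<delta>} (\<lambda>n t. \<Sum>i<n. T' t (e i))"
      using bound M_e by (intro Weierstrass_m_test') auto
    show "((\<lambda>t. T t (e n)) has_field_derivative T' t (e n)) (at t within {-\<delta><..<\<delta>})" for n t
      unfolding T_def T'_def by (auto intro!: derivative_eq_intros)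
    show "(0::real) \<in> {-\<delta><..<\<delta>}" using \<delta> by auto
    then show "summable (\<lambda>n. T 0 (e n))"
      using sums_e[OF T_sum] sums_summable by blast
  qed (use \<delta> in auto)
  have "((\<lambda>t. f (w + t *\<^sub>R axis k 1)) has_field_derivative (\<Sum>n. T' 0 (e n))) (at 0)"
    by (rule has_field_derivative_transform_within_open[OF deriv, of "{-\<delta><..<\<delta>}"])
      (use \<delta> sums_e[OF T_sum] in \<open>auto simp: sums_iff\<close>)
  \<comment> \<open>Convergence along one enumeration could be conditional; comparison with
    \<open>M\<close> makes it unconditional, so its value is the sum over all multi-indices.\<close>
  moreover have "T' 0 summable_on UNIV"
    by (rule summable_on_iff_abs_summable_on_real[THEN iffD2], rule summable_on_comparison_test[OF M_summable])
      (use bound \<delta> in auto)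
  then have "(T' 0 has_sum (\<Sum>n. T' 0 (e n))) UNIV"
    using sums_unique[OF sums_e[OF has_sum_infsum]] has_sum_infsum by metis
  ultimately show ?thesis
    unfolding T'_def K_def by auto
qed

text \<open>Without the vanishing terms only multi-indices with positive \<open>k\<close>-th entry
  remain, and raising that entry by one maps all multi-indices bijectively onto these.\<close>

lemma has_sum_lower_index:
  fixes h :: "('d \<Rightarrow> nat) \<Rightarrow> 'b::real_normed_vector"
  assumes "(h has_sum s) UNIV" and "\<And>\<alpha>. \<alpha> k = 0 \<Longrightarrow> h \<alpha> = 0"
  shows "((\<lambda>\<beta>. h (\<beta>(k := Suc (\<beta> k)))) has_sum s) UNIV"
proof -
  have "(h has_sum s) {\<alpha>. \<alpha> k \<noteq> 0}"
    using assms by (subst has_sum_cong_neutral[of UNIV _ h h]) auto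
  then show ?thesis
    by (subst has_sum_reindex_bij_witness[where S = UNIV and T = "{\<alpha>. \<alpha> k \<noteq> 0}" and h = h and s' = s
          and i = "\<lambda>\<alpha>. \<alpha>(k := \<alpha> k - 1)" and j = "\<lambda>\<beta>. \<beta>(k := Suc (\<beta> k))"]) auto
qed

text \<open>The differentiated series, reindexed, is a power series on the same ball, so partial
  differentiation can be repeated.\<close>

lemma real_analytic_at_partial_deriv:
  fixes f :: "real ^ 'd \<Rightarrow> real"
  assumes "real_analytic_at f a"
  shows "((\<lambda>t. f (a + t *\<^sub>R axis k 1)) has_real_derivative partial_deriv k f a) (at 0)"
    and "real_analytic_at (partial_deriv k f) a"
proof -
  from assms obtain r c where r: "r > 0" and f: "\<And>w. w \<in> ball a r \<Longrightarrow>
      ((\<lambda>\<alpha>. (\<Prod>i\<in>UNIV. (w $ i - a $ i) ^ \<alpha> i) * c \<alpha>) has_sum f w) UNIV"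
    unfolding real_analytic_at_def real_scaleR_def by blast
  let ?D = "\<lambda>w \<alpha>. real (\<alpha> k) * (w $ k - a $ k) ^ (\<alpha> k - 1) *
        ((\<Prod>i\<in>UNIV-{k}. (w $ i - a $ i) ^ \<alpha> i) * c \<alpha>)"
  have D: "((\<lambda>t. f (w + t *\<^sub>R axis k 1)) has_real_derivative partial_deriv k f w) (at 0) \<and>
      (?D w has_sum partial_deriv k f w) UNIV" if w: "w \<in> ball a r" for w
  proof -
    obtain g where g: "((\<lambda>t. f (w + t *\<^sub>R axis k 1)) has_real_derivative g) (at 0)"
      "(?D w has_sum g) UNIV"
      using multi_series_derivative[of a r c f w k] f w by blast
    moreover have "partial_deriv k f w = g"
      unfolding partial_deriv_def
      using g(1) by (intro vector_derivative_at) (simp add: has_real_derivative_iff_has_vector_derivative)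
    ultimately show ?thesis by simp
  qed
  show "((\<lambda>t. f (a + t *\<^sub>R axis k 1)) has_real_derivative partial_deriv k f a) (at 0)"
    using D[of a] r by simp
  \<comment> \<open>The power rule turns the coefficient at \<open>\<beta>\<close> with
    \<open>k\<close>-th entry raised by one into the coefficient at \<open>\<beta>\<close>.\<close>
  define d where "d = (\<lambda>\<beta>. real (Suc (\<beta> k)) * c (\<beta>(k := Suc (\<beta> k))))"
  have "((\<lambda>\<beta>. (\<Prod>i\<in>UNIV. (w $ i - a $ i) ^ \<beta> i) *\<^sub>R d \<beta>) has_sum partial_deriv k f w) UNIV"
    if "w \<in> ball a r" for w
  proof -
    have "((\<lambda>\<beta>. ?D w (\<beta>(k := Suc (\<beta> k)))) has_sum partial_deriv k f w) UNIV"
      using D[OF that] by (intro has_sum_lower_index) auto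
    moreover have "?D w (\<beta>(k := Suc (\<beta> k))) = (\<Prod>i\<in>UNIV. (w $ i - a $ i) ^ \<beta> i) *\<^sub>R d \<beta>" for \<beta>
      by (subst prod.remove[of UNIV k]) (auto simp: d_def)
    ultimately show ?thesis by simp
  qed
  then show "real_analytic_at (partial_deriv k f) a"
    unfolding real_analytic_at_def using r by blast
qed

lemma real_analytic_at_bounded_linear:
  assumes "bounded_linear h" "real_analytic_at f a"
  shows "real_analytic_at (\<lambda>w. h (f w)) a"
proof -
  from assms(2) obtain r c where r: "r > 0" and f: "\<And>w. w \<in> ball a r \<Longrightarrow>
      ((\<lambda>\<alpha>. (\<Prod>i\<in>UNIV. (w $ i - a $ i) ^ \<alpha> i) *\<^sub>R c \<alpha>) has_sum f w) UNIV"
    unfolding real_analytic_at_def by blast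
  have "((\<lambda>\<alpha>. (\<Prod>i\<in>UNIV. (w $ i - a $ i) ^ \<alpha> i) *\<^sub>R h (c \<alpha>)) has_sum h (f w)) UNIV"
    if "w \<in> ball a r" for w
    using has_sum_bounded_linear[OF assms(1) f[OF that]]
    by (simp add: linear_cmul[OF bounded_linear.linear[OF assms(1)]] o_def)
  with r show ?thesis
    unfolding real_analytic_at_def by (intro exI[of _ r] exI[of _ "\<lambda>\<alpha>. h (c \<alpha>)"] conjI) auto
qed

text \<open>Hypothesis and second conclusion have the same shape, so the lemma can be applied to its
  own output to obtain second derivatives.\<close>

lemma real_analytic_on_partial_field:
  fixes F :: "real ^ 'd \<Rightarrow> 'b::euclidean_space"
  assumes "\<And>b. b \<in> Basis \<Longrightarrow> real_analytic_on (\<lambda>w. F w \<bullet> b) U"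
  obtains dF where
    "\<And>k w. w \<in> U \<Longrightarrow> ((\<lambda>t. F (w + t *\<^sub>R axis k 1)) has_vector_derivative dF k w) (at 0)"
    "\<And>k b. b \<in> Basis \<Longrightarrow> real_analytic_on (\<lambda>w. dF k w \<bullet> b) U"
proof
  define dF where "dF = (\<lambda>k w. \<Sum>b\<in>Basis. partial_deriv k (\<lambda>w. F w \<bullet> b) w *\<^sub>R b)"
  have comp: "dF k w \<bullet> b = partial_deriv k (\<lambda>w. F w \<bullet> b) w" if "b \<in> Basis" for k w b
    using that by (simp add: dF_def inner_sum_left_Basis)
  show "((\<lambda>t. F (w + t *\<^sub>R axis k 1)) has_vector_derivative dF k w) (at 0)" if "w \<in> U" for k w
    unfolding has_vector_derivative_def
  proof (subst has_derivative_componentwise_within, rule ballI)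
    fix b :: 'b assume b: "b \<in> Basis"
    then have "((\<lambda>t. F (w + t *\<^sub>R axis k 1) \<bullet> b) has_real_derivative
        partial_deriv k (\<lambda>w. F w \<bullet> b) w) (at 0)"
      using assms that by (intro real_analytic_at_partial_deriv(1)) (auto simp: real_analytic_on_def)
    then show "((\<lambda>t. F (w + t *\<^sub>R axis k 1) \<bullet> b) has_derivative (\<lambda>t. (t *\<^sub>R dF k w) \<bullet> b)) (at 0)"
      by (simp add: has_field_derivative_def comp[OF b] mult_commute_abs)
  qed
  show "real_analytic_on (\<lambda>w. dF k w \<bullet> b) U" if "b \<in> Basis" for k b
    using assms[OF that] real_analytic_at_partial_deriv(2)[of "\<lambda>w. F w \<bullet> b"]
    by (auto simp: real_analytic_on_def comp[OF that])
qed

text \<open>\<open>partial_deriv\<close> rests on the choice operator in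
  \<open>vector_derivative\<close>; by the chain rule, differentiability ensures that the chosen
  value is a genuine derivative.\<close>

lemma has_vector_derivative_partial_deriv:
  fixes f :: "real ^ 'd \<Rightarrow> 'b::real_normed_vector"
  assumes "f differentiable_on W" "open W" "w \<in> W"
  shows "((\<lambda>t. f (w + t *\<^sub>R axis k 1)) has_vector_derivative partial_deriv k f w) (at 0)"
proof -
  obtain D where D: "(f has_derivative D) (at w)"
    using assms by (metis at_within_open differentiable_def differentiable_on_def)
  have "((\<lambda>t. w + t *\<^sub>R axis k 1) has_derivative (\<lambda>t. t *\<^sub>R axis k 1)) (at (0::real))"
    by (auto intro!: derivative_eq_intros)
  then have "((\<lambda>t. f (w + t *\<^sub>R axis k 1)) has_derivative (\<lambda>t. D (t *\<^sub>R axis k 1))) (at (0::real))"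
    by (rule has_derivative_compose) (use D in simp)
  then have "((\<lambda>t. f (w + t *\<^sub>R axis k 1)) has_vector_derivative D (axis k 1)) (at 0)"
    using linear_cmul[OF has_derivative_linear[OF D]] by (simp add: has_vector_derivative_def)
  then show ?thesis
    unfolding partial_deriv_def by (simp add: vector_derivative_at)
qed

section \<open>Reduced matrices\<close>

lemma bounded_bilinear_matrix_vector_mult:
  "bounded_bilinear ((*v) :: real ^ 'n ^ 'm \<Rightarrow> real ^ 'n \<Rightarrow> real ^ 'm)"
proof -
  have "linear (\<lambda>M :: real ^ 'n ^ 'm. M *v x)" for x
    by (intro linearI) (simp_all add: matrix_vector_mult_add_rdistrib scaleR_matrix_vector_assoc)
  then show ?thesis
    by (auto simp: bilinear_conv_bounded_bilinear[symmetric] bilinear_def)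
qed

lemmas has_vector_derivative_matrix_vector =
  bounded_bilinear.has_vector_derivative[OF bounded_bilinear_matrix_vector_mult]

lemmas has_vector_derivative_inner =
  bounded_bilinear.has_vector_derivative[OF bounded_bilinear_inner]

lemma symmetric_mat_inner:
  assumes "symmetric_mat M"
  shows "x \<bullet> (M *v y) = (M *v x) \<bullet> y"
  by (metis assms symmetric_mat_def dot_lmul_matrix transpose_matrix_vector)

lemma reduced_mat_mult: "reduced_mat V M *v y = transpose V *v (M *v (V *v y))"
  by (simp only: reduced_mat_def matrix_vector_mul_assoc matrix_mul_assoc)

text \<open>Reduced bilinear forms become full ones at vectors of the subspace, which is how both
  pencils are compared throughout.\<close>

lemma inner_reduced_mat: "x \<bullet> (reduced_mat V M *v y) = (V *v x) \<bullet> (M *v (V *v y))"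
  by (metis dot_lmul_matrix inner_commute reduced_mat_mult transpose_matrix_vector)

lemma symmetric_mat_reduced:
  assumes "symmetric_mat M"
  shows "symmetric_mat (reduced_mat V M)"
  using assms by (simp add: symmetric_mat_def reduced_mat_def matrix_transpose_mul matrix_mul_assoc)

lemma orthonormal_basis_of_range:
  assumes "orthonormal_basis_of V S"
  shows "S = range ((*v) V)"
proof -
  have "span (columns V) \<subseteq> range ((*v) V)"
    by (intro span_minimal linear_subspace_image) (auto simp: columns_image_basis)
  then show ?thesis
    using assms matrix_vector_mult_in_columnspace[of V] by (auto simp: orthonormal_basis_of_def)
qed

lemma orthonormal_basis_of_left_inverse:
  assumes "orthonormal_basis_of V S"
  shows "transpose V *v (V *v y) = y"
  using assms by (simp only: orthonormal_basis_of_def matrix_vector_mul_assoc) simp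

text \<open>\<open>V ** transpose V\<close> is the orthogonal projection onto the column space,
  hence the identity there.\<close>

lemma orthonormal_basis_of_projection:
  assumes "orthonormal_basis_of V S" "x \<in> S"
  shows "V *v (transpose V *v x) = x"
  using assms orthonormal_basis_of_range orthonormal_basis_of_left_inverse by (metis imageE)

lemma orthonormal_basis_of_inj:
  assumes "orthonormal_basis_of V S" "y \<noteq> 0"
  shows "V *v y \<noteq> 0"
  using assms orthonormal_basis_of_left_inverse by (metis matrix_vector_mult_0_right)

text \<open>Since \<open>V\<close> maps \<open>transpose V *v x\<close> back to \<open>x\<close>,
  the reduced equation is the full one multiplied by \<open>transpose V\<close>, and the
  normalisation carries over.\<close>

lemma normalised_eigenpair_reduced:
  assumes "normalised_eigenpair A B l x" "orthonormal_basis_of V S" "x \<in> S"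
  shows "normalised_eigenpair (reduced_mat V A) (reduced_mat V B) l (transpose V *v x)"
proof -
  have x: "V *v (transpose V *v x) = x"
    by (rule orthonormal_basis_of_projection[OF assms(2,3)])
  moreover have "transpose V *v x \<noteq> 0"
    using x assms(1) by (metis matrix_vector_mult_0_right eigenpair_def normalised_eigenpair_def)
  ultimately show ?thesis
    using assms(1) unfolding normalised_eigenpair_def eigenpair_def inner_reduced_mat
    by (simp add: reduced_mat_mult matrix_vector_mult_scaleR del: transpose_matrix_vector)
qed

section \<open>Rayleigh quotients\<close>

text \<open>Eigenvectors of distinct eigenvalues are \<open>B\<close>-orthogonal, hence independent.
  Finiteness is what gives \<open>Min\<close> in \<open>min_eigenvalue\<close> its meaning.\<close>

lemma finite_eigenvalues:
  fixes A B :: "real ^ 'n ^ 'n"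
  assumes A: "symmetric_mat A" and B: "symmetric_mat B" "pos_def_mat B"
  shows "finite {l. \<exists>x. eigenpair A B l x}"
proof -
  let ?E = "{l. \<exists>x. eigenpair A B l x}"
  define v where "v = (\<lambda>l. SOME x. eigenpair A B l x)"
  have v: "eigenpair A B l (v l)" if "l \<in> ?E" for l
    using that unfolding v_def by (auto intro: someI)
  have pos: "v l \<bullet> (B *v v l) > 0" if "l \<in> ?E" for l
    using v[OF that] B(2) by (auto simp: eigenpair_def pos_def_mat_def)
  have orth: "v l \<bullet> (B *v v m) = 0" if "l \<in> ?E" "m \<in> ?E" "l \<noteq> m" for l m
  proof -
    have "m * (v l \<bullet> (B *v v m)) = v l \<bullet> (A *v v m)"
      using v[OF that(2)] by (simp add: eigenpair_def)
    also have "\<dots> = (A *v v l) \<bullet> v m"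
      by (rule symmetric_mat_inner[OF A])
    also have "\<dots> = l * (v l \<bullet> (B *v v m))"
      using v[OF that(1)] symmetric_mat_inner[OF B(1), of "v l" "v m"] by (simp add: eigenpair_def)
    finally show ?thesis using that(3) by simp
  qed
  have inj: "inj_on v ?E"
    using pos orth by (metis (no_types, lifting) inj_onI less_irrefl)
  have "independent (v ` ?E)"
    unfolding dependent_def
  proof (intro notI, elim bexE)
    fix x assume "x \<in> v ` ?E" "x \<in> span (v ` ?E - {x})"
    then obtain l where l: "l \<in> ?E" "x = v l" by blast
    \<comment> \<open>The other eigenvectors span a space that is \<open>B\<close>-orthogonal to
      \<open>v l\<close>, but \<open>v l\<close> is not \<open>B\<close>-orthogonal to
      itself.\<close>
    have "span (v ` ?E - {x}) \<subseteq> {y. v l \<bullet> (B *v y) = 0}"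
    proof (rule span_minimal)
      show "v ` ?E - {x} \<subseteq> {y. v l \<bullet> (B *v y) = 0}"
        using l orth by blast
      show "subspace {y. v l \<bullet> (B *v y) = 0}"
        by (auto simp: subspace_def matrix_vector_right_distrib inner_add_right matrix_vector_mult_scaleR)
    qed
    then show False
      using \<open>x \<in> span (v ` ?E - {x})\<close> pos[OF l(1)] l(2) by auto
  qed
  then show ?thesis
    using inj finiteI_independent finite_imageD by blast
qed

text \<open>Moving from \<open>x\<close> along \<open>M *v x\<close> changes the form at first order
  by twice the squared norm of \<open>M *v x\<close>, so a small step backwards would make it
  negative unless that vector is zero.\<close>

lemma psd_kernel:
  fixes M :: "real ^ 'n ^ 'n"
  assumes M: "symmetric_mat M" and nonneg: "\<And>y. 0 \<le> y \<bullet> (M *v y)" and x: "x \<bullet> (M *v x) = 0"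
  shows "M *v x = 0"
proof -
  let ?z = "M *v x"
  have "0 \<le> (2 * t) * (?z \<bullet> ?z) + t\<^sup>2 * (?z \<bullet> (M *v ?z))" for t
  proof -
    have "0 \<le> (x + t *\<^sub>R ?z) \<bullet> (M *v (x + t *\<^sub>R ?z))"
      by (rule nonneg)
    also have "\<dots> = t * (x \<bullet> (M *v ?z)) + t * (?z \<bullet> ?z) + t\<^sup>2 * (?z \<bullet> (M *v ?z))"
      using x by (simp add: matrix_vector_right_distrib matrix_vector_mult_scaleR inner_add_left
          inner_add_right power2_eq_square algebra_simps)
    also have "x \<bullet> (M *v ?z) = ?z \<bullet> ?z"
      by (rule symmetric_mat_inner[OF M])
    finally show ?thesis by simp
  qed
  note ineq = this
  let ?a = "?z \<bullet> ?z" and ?c = "?z \<bullet> (M *v ?z)"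
  have "?c \<ge> 0" by (rule nonneg)
  \<comment> \<open>The summand 1 avoids division by zero; with this \<open>t\<close> the inequality
    collapses to a nonpositive multiple of \<open>t\<^sup>2\<close>.\<close>
  define t where "t = - (?a / (?c + 1))"
  have a: "?a = - t * (?c + 1)"
    using \<open>?c \<ge> 0\<close> by (simp add: t_def)
  have "0 \<le> - (t\<^sup>2) * (?c + 2)"
    using ineq[of t] unfolding a by (simp add: algebra_simps power2_eq_square)
  then have "t = 0"
    using \<open>?c \<ge> 0\<close> by (simp add: mult_le_0_iff)
  then show ?thesis using a by simp
qed

text \<open>The Rayleigh quotient attains its minimum \<open>l\<close> on the compact unit sphere.
  Then \<open>A - l *\<^sub>R B\<close> is positive semidefinite and annihilates the minimiser, so
  \<open>l\<close> is an eigenvalue; any other eigenvalue is the quotient at its eigenvector, hence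
  no smaller.\<close>

lemma min_eigenvalue_Rayleigh:
  fixes A B :: "real ^ 'n ^ 'n"
  assumes A: "symmetric_mat A" and B: "symmetric_mat B" "pos_def_mat B"
  shows "min_eigenvalue A B * (y \<bullet> (B *v y)) \<le> y \<bullet> (A *v y)"
    and "\<exists>x. x \<noteq> 0 \<and> x \<bullet> (A *v x) = min_eigenvalue A B * (x \<bullet> (B *v x))"
proof -
  define q where "q = (\<lambda>x. (x \<bullet> (A *v x)) / (x \<bullet> (B *v x)))"
  have pos: "x \<bullet> (B *v x) > 0" if "x \<noteq> 0" for x
    using B(2) that by (auto simp: pos_def_mat_def)
  have nz: "x \<bullet> (B *v x) \<noteq> 0" if "x \<in> sphere 0 1" for x
    using pos[of x] that by (cases "x = 0") auto
  have "continuous_on (sphere 0 1) q"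
    unfolding q_def using nz
    by (intro continuous_intros linear_continuous_on matrix_vector_mul_bounded_linear) auto
  moreover have "axis undefined 1 \<in> (sphere 0 1 :: (real ^ 'n) set)"
    by simp
  ultimately obtain x where x: "x \<in> sphere 0 1" and min: "\<And>y. y \<in> sphere 0 1 \<Longrightarrow> q x \<le> q y"
    using continuous_attains_inf[of "sphere 0 1" q] by auto
  define l where "l = q x"
  have x0: "x \<noteq> 0" using x by auto
  have ray: "l * (y \<bullet> (B *v y)) \<le> y \<bullet> (A *v y)" for y
  proof (cases "y = 0")
    case False
    \<comment> \<open>The quotient is homogeneous of degree zero, so the minimum over the sphere
      bounds it at every nonzero vector.\<close>
    have "q ((1 / norm y) *\<^sub>R y) = q y"
      using False by (simp add: q_def matrix_vector_mult_scaleR)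
    then have "l \<le> q y"
      using min[of "(1 / norm y) *\<^sub>R y"] False by (simp add: l_def)
    then show ?thesis
      using pos[OF False] by (simp add: q_def field_simps)
  qed simp
  have eq: "x \<bullet> (A *v x) = l * (x \<bullet> (B *v x))"
    using pos[OF x0] by (simp add: l_def q_def)
  have sub: "(A - l *\<^sub>R B) *v y = A *v y - l *\<^sub>R (B *v y)" for y
    by (simp add: matrix_vector_mult_diff_rdistrib scaleR_matrix_vector_assoc)
  have "(A - l *\<^sub>R B) *v x = 0"
  proof (rule psd_kernel)
    show "symmetric_mat (A - l *\<^sub>R B)"
      using A B by (simp add: symmetric_mat_def transpose_def vec_eq_iff)
  qed (use ray eq in \<open>simp_all add: sub inner_diff_right\<close>)
  then have "eigenpair A B l x"
    using x0 by (simp add: eigenpair_def sub)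
  moreover have "l \<le> m" if "eigenpair A B m y" for m y
  proof -
    have "y \<noteq> 0" "y \<bullet> (A *v y) = m * (y \<bullet> (B *v y))"
      using that by (auto simp: eigenpair_def)
    then show ?thesis using ray[of y] pos[of y] by simp
  qed
  ultimately have "min_eigenvalue A B = l"
    unfolding min_eigenvalue_def
    by (intro Min_eqI finite_eigenvalues[OF A B]) auto
  then show "min_eigenvalue A B * (y \<bullet> (B *v y)) \<le> y \<bullet> (A *v y)"
    and "\<exists>x. x \<noteq> 0 \<and> x \<bullet> (A *v x) = min_eigenvalue A B * (x \<bullet> (B *v x))"
    using ray eq x0 by auto
qed

lemma pos_def_mat_reduced:
  assumes "pos_def_mat B" "orthonormal_basis_of V S"
  shows "pos_def_mat (reduced_mat V B)"
  using assms orthonormal_basis_of_inj[OF assms(2)]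
  by (auto simp: pos_def_mat_def inner_reduced_mat)

text \<open>The minimiser for \<open>V1\<close> is a test vector for the full pencil and, since
  \<open>S1\<close> lies in \<open>S2\<close>, for the one on \<open>S2\<close>.\<close>

lemma min_eigenvalue_reduced_mono:
  fixes A B :: "real ^ 'n ^ 'n" and V1 :: "real ^ 'm1 ^ 'n" and V2 :: "real ^ 'm2 ^ 'n"
  assumes A: "symmetric_mat A" and B: "symmetric_mat B" "pos_def_mat B"
    and V1: "orthonormal_basis_of V1 S1" and V2: "orthonormal_basis_of V2 S2" and "S1 \<subseteq> S2"
  shows "min_eigenvalue A B \<le> min_eigenvalue (reduced_mat V1 A) (reduced_mat V1 B)"
    and "min_eigenvalue (reduced_mat V2 A) (reduced_mat V2 B)
       \<le> min_eigenvalue (reduced_mat V1 A) (reduced_mat V1 B)"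
proof -
  note R1 = min_eigenvalue_Rayleigh[OF symmetric_mat_reduced[OF A, of V1]
      symmetric_mat_reduced[OF B(1), of V1] pos_def_mat_reduced[OF B(2) V1]]
  note R2 = min_eigenvalue_Rayleigh[OF symmetric_mat_reduced[OF A, of V2]
      symmetric_mat_reduced[OF B(1), of V2] pos_def_mat_reduced[OF B(2) V2]]
  obtain y where y: "y \<noteq> 0" and eq: "y \<bullet> (reduced_mat V1 A *v y) =
      min_eigenvalue (reduced_mat V1 A) (reduced_mat V1 B) * (y \<bullet> (reduced_mat V1 B *v y))"
    using R1(2) by blast
  have pos: "(V1 *v y) \<bullet> (B *v (V1 *v y)) > 0"
    using B(2) orthonormal_basis_of_inj[OF V1 y] by (auto simp: pos_def_mat_def)
  show "min_eigenvalue A B \<le> min_eigenvalue (reduced_mat V1 A) (reduced_mat V1 B)"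
    using min_eigenvalue_Rayleigh(1)[OF A B, of "V1 *v y"] eq pos by (simp add: inner_reduced_mat)
  have "V1 *v y \<in> S2"
    using \<open>S1 \<subseteq> S2\<close> orthonormal_basis_of_range[OF V1] by auto
  then obtain z where z: "V1 *v y = V2 *v z"
    using orthonormal_basis_of_range[OF V2] by auto
  show "min_eigenvalue (reduced_mat V2 A) (reduced_mat V2 B)
       \<le> min_eigenvalue (reduced_mat V1 A) (reduced_mat V1 B)"
    using R2(1)[of z] eq pos by (simp add: inner_reduced_mat z)
qed
section \<open>Perturbation of eigenpairs\<close>

text \<open>The three claims come from differentiating the eigenvalue equation, testing the result
  with \<open>x 0\<close>, and differentiating the normalisation. The first is stated against a test
  vector \<open>v\<close> so that \<open>inner_reduced_mat\<close> can rewrite its reduced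
  version.\<close>

lemma eigenpair_curve_derivative:
  fixes P Q :: "real \<Rightarrow> real ^ 'n ^ 'n"
  assumes P: "(P has_vector_derivative P') (at 0)" and Q: "(Q has_vector_derivative Q') (at 0)"
    and l: "(l has_vector_derivative l') (at 0)" and x: "(x has_vector_derivative x') (at 0)"
    and S: "open S" "0 \<in> S" "\<And>t. t \<in> S \<Longrightarrow> normalised_eigenpair (P t) (Q t) (l t) (x t)"
    and sym: "symmetric_mat (P 0)" "symmetric_mat (Q 0)"
  shows "v \<bullet> (P 0 *v x') - l 0 * (v \<bullet> (Q 0 *v x')) + v \<bullet> (P' *v x 0) - l' * (v \<bullet> (Q 0 *v x 0))
      - l 0 * (v \<bullet> (Q' *v x 0)) = 0"
    and "l' = x 0 \<bullet> (P' *v x 0) - l 0 * (x 0 \<bullet> (Q' *v x 0))"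
    and "2 * (x' \<bullet> (Q 0 *v x 0)) + x 0 \<bullet> (Q' *v x 0) = 0"
proof -
  note Qx = has_vector_derivative_matrix_vector[OF Q x]
  have eig: "P t *v x t = l t *\<^sub>R (Q t *v x t)" "x t \<bullet> (Q t *v x t) = 1" if "t \<in> S" for t
    using S(3)[OF that] by (auto simp: normalised_eigenpair_def eigenpair_def)
  \<comment> \<open>This derivative is computed from the right side of the eigenvalue equation,
    which agrees with the left near 0; uniqueness of derivatives then equates it with the product
    rule for the left side.\<close>
  have "((\<lambda>t. P t *v x t) has_vector_derivative
      l 0 *\<^sub>R (Q 0 *v x' + Q' *v x 0) + l' *\<^sub>R (Q 0 *v x 0)) (at 0)"
    by (rule has_vector_derivative_transform_within_open[OF
          bounded_bilinear.has_vector_derivative[OF bounded_bilinear_scaleR l Qx] S(1,2)])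
      (simp add: eig)
  then have "P 0 *v x' + P' *v x 0 = l 0 *\<^sub>R (Q 0 *v x' + Q' *v x 0) + l' *\<^sub>R (Q 0 *v x 0)"
    using has_vector_derivative_matrix_vector[OF P x] vector_derivative_unique_at by blast
  then have "v \<bullet> (P 0 *v x' + P' *v x 0) =
      v \<bullet> (l 0 *\<^sub>R (Q 0 *v x' + Q' *v x 0) + l' *\<^sub>R (Q 0 *v x 0))" for v
    by simp
  then have eq: "v \<bullet> (P 0 *v x') - l 0 * (v \<bullet> (Q 0 *v x')) + v \<bullet> (P' *v x 0)
      - l' * (v \<bullet> (Q 0 *v x 0)) - l 0 * (v \<bullet> (Q' *v x 0)) = 0" for v
    by (simp add: inner_add_right algebra_simps)
  show "v \<bullet> (P 0 *v x') - l 0 * (v \<bullet> (Q 0 *v x')) + v \<bullet> (P' *v x 0) - l' * (v \<bullet> (Q 0 *v x 0))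
      - l 0 * (v \<bullet> (Q' *v x 0)) = 0"
    by (rule eq)
  \<comment> \<open>Symmetry moves the matrices onto \<open>x 0\<close>, so the terms with
    \<open>x'\<close> cancel.\<close>
  have "x 0 \<bullet> (P 0 *v x') = l 0 * (x 0 \<bullet> (Q 0 *v x'))"
    by (simp add: symmetric_mat_inner[OF sym(1)] symmetric_mat_inner[OF sym(2)] eig[OF S(2)])
  then show "l' = x 0 \<bullet> (P' *v x 0) - l 0 * (x 0 \<bullet> (Q' *v x 0))"
    using eq[of "x 0"] eig[OF S(2)] by simp
  have "((\<lambda>t. x t \<bullet> (Q t *v x t)) has_vector_derivative 0) (at 0)"
    by (rule has_vector_derivative_transform_within_open[OF has_vector_derivative_const S(1,2)])
      (simp add: eig)
  then have "x 0 \<bullet> (Q 0 *v x' + Q' *v x 0) + x' \<bullet> (Q 0 *v x 0) = 0"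
    using has_vector_derivative_inner[OF x Qx] vector_derivative_unique_at by blast
  then show "2 * (x' \<bullet> (Q 0 *v x 0)) + x 0 \<bullet> (Q' *v x 0) = 0"
    using symmetric_mat_inner[OF sym(2), of "x 0" x'] by (simp add: inner_add_right inner_commute)
qed

section \<open>Coordinate lines and pencils with two orders of partial derivatives\<close>

lemma open_line_preimage:
  fixes W :: "(real ^ 'd) set"
  assumes "open W"
  shows "open {t. w + t *\<^sub>R axis k 1 \<in> W}"
proof -
  have "continuous_on UNIV (\<lambda>t. w + t *\<^sub>R axis k 1)"
    by (intro continuous_intros)
  then show ?thesis
    using open_vimage[OF assms, of "\<lambda>t. w + t *\<^sub>R axis k 1"] by (simp add: vimage_def)
qed

lemma smooth_on_differentiable:
  assumes "smooth_on f W"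
  shows "f differentiable_on W"
  using assms Ck_on.simps(2) unfolding smooth_on_def by blast

text \<open>Transposition is linear, so the transposed derivative is a derivative of the same
  curve.\<close>

lemma symmetric_mat_derivative:
  fixes P :: "real \<Rightarrow> real ^ 'n ^ 'n"
  assumes P: "(P has_vector_derivative P') (at t)" and "open S" "t \<in> S"
    and sym: "\<And>s. s \<in> S \<Longrightarrow> symmetric_mat (P s)"
  shows "symmetric_mat P'"
proof -
  have "linear (transpose :: real ^ 'n ^ 'n \<Rightarrow> _)"
    by (intro linearI) (simp_all add: transpose_def vec_eq_iff)
  then have "bounded_linear (transpose :: real ^ 'n ^ 'n \<Rightarrow> _)"
    by (rule linear_conv_bounded_linear[THEN iffD1])
  from bounded_linear.has_vector_derivative[OF this P]
  have "(P has_vector_derivative transpose P') (at t)"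
    by (rule has_vector_derivative_transform_within_open[OF _ \<open>open S\<close> \<open>t \<in> S\<close>])
      (use sym in \<open>simp add: symmetric_mat_def\<close>)
  from vector_derivative_unique_at[OF this P] show ?thesis
    by (simp only: symmetric_mat_def)
qed

text \<open>Only derivative fields are recorded, not power series, so that reduced pencils form
  further instances. In \<open>ddP j k\<close> the direction \<open>k\<close> is differentiated
  first, then \<open>j\<close>.\<close>

locale smooth_pencil =
  fixes U :: "(real ^ 'd) set" and P Q :: "real ^ 'd \<Rightarrow> real ^ 'n ^ 'n"
    and dP dQ :: "'d \<Rightarrow> real ^ 'd \<Rightarrow> real ^ 'n ^ 'n"
    and ddP ddQ :: "'d \<Rightarrow> 'd \<Rightarrow> real ^ 'd \<Rightarrow> real ^ 'n ^ 'n"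
  assumes open_U: "open U"
    and sym: "w \<in> U \<Longrightarrow> symmetric_mat (P w)" "w \<in> U \<Longrightarrow> symmetric_mat (Q w)"
    and dP: "w \<in> U \<Longrightarrow> ((\<lambda>t. P (w + t *\<^sub>R axis k 1)) has_vector_derivative dP k w) (at 0)"
    and dQ: "w \<in> U \<Longrightarrow> ((\<lambda>t. Q (w + t *\<^sub>R axis k 1)) has_vector_derivative dQ k w) (at 0)"
    and ddP: "w \<in> U \<Longrightarrow> ((\<lambda>t. dP k (w + t *\<^sub>R axis j 1)) has_vector_derivative ddP j k w) (at 0)"
    and ddQ: "w \<in> U \<Longrightarrow> ((\<lambda>t. dQ k (w + t *\<^sub>R axis j 1)) has_vector_derivative ddQ j k w) (at 0)"
begin

lemma sym_derivative:
  assumes "w \<in> U"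
  shows "symmetric_mat (dP k w)" "symmetric_mat (dQ k w)"
  by (rule symmetric_mat_derivative[OF dP[OF assms] open_line_preimage[OF open_U, of w k]],
      use assms sym in auto)
    (rule symmetric_mat_derivative[OF dQ[OF assms] open_line_preimage[OF open_U, of w k]],
      use assms sym in auto)

text \<open>The curve formulas on the coordinate line through \<open>w\<close>. They hold at every
  \<open>w\<close> in \<open>W\<close> and \<open>U\<close>, which allows the formula for
  \<open>partial_deriv k l\<close> to be differentiated again.\<close>

lemma first_order:
  assumes "open W" "smooth_on l W" "smooth_on x W"
    and eig: "\<And>w. w \<in> W \<Longrightarrow> normalised_eigenpair (P w) (Q w) (l w) (x w)"
    and w: "w \<in> W" "w \<in> U"
  shows "v \<bullet> (P w *v partial_deriv k x w) - l w * (v \<bullet> (Q w *v partial_deriv k x w))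
      + v \<bullet> (dP k w *v x w) - partial_deriv k l w * (v \<bullet> (Q w *v x w)) - l w * (v \<bullet> (dQ k w *v x w)) = 0"
    and "partial_deriv k l w = x w \<bullet> (dP k w *v x w) - l w * (x w \<bullet> (dQ k w *v x w))"
    and "2 * (partial_deriv k x w \<bullet> (Q w *v x w)) + x w \<bullet> (dQ k w *v x w) = 0"
proof -
  note D = has_vector_derivative_partial_deriv[OF smooth_on_differentiable \<open>open W\<close> w(1)]
  let ?S = "{t. w + t *\<^sub>R axis k 1 \<in> W}"
  have "0 \<in> ?S" "symmetric_mat (P (w + 0 *\<^sub>R axis k 1))" "symmetric_mat (Q (w + 0 *\<^sub>R axis k 1))"
    and "\<And>t. t \<in> ?S \<Longrightarrow> normalised_eigenpair (P (w + t *\<^sub>R axis k 1)) (Q (w + t *\<^sub>R axis k 1))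
      (l (w + t *\<^sub>R axis k 1)) (x (w + t *\<^sub>R axis k 1))"
    using w sym eig by auto
  note E = eigenpair_curve_derivative[OF dP[OF w(2)] dQ[OF w(2)] D[OF assms(2)] D[OF assms(3)]
      open_line_preimage[OF \<open>open W\<close>] this(1,4,2,3)]
  show "v \<bullet> (P w *v partial_deriv k x w) - l w * (v \<bullet> (Q w *v partial_deriv k x w))
      + v \<bullet> (dP k w *v x w) - partial_deriv k l w * (v \<bullet> (Q w *v x w)) - l w * (v \<bullet> (dQ k w *v x w)) = 0"
    using E(1) by simp
  show "partial_deriv k l w = x w \<bullet> (dP k w *v x w) - l w * (x w \<bullet> (dQ k w *v x w))"
    using E(2) by simp
  show "2 * (partial_deriv k x w \<bullet> (Q w *v x w)) + x w \<bullet> (dQ k w *v x w) = 0"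
    using E(3) by simp
qed

text \<open>Differentiating the first-order formula brings in only first derivatives of the
  eigenvector; symmetry merges its two occurrences into the factor 2.\<close>

lemma second_order:
  assumes W: "open W" "smooth_on l W" "smooth_on x W"
    and eig: "\<And>w. w \<in> W \<Longrightarrow> normalised_eigenpair (P w) (Q w) (l w) (x w)"
    and w: "w \<in> W" "w \<in> U"
  shows "partial_deriv j (partial_deriv k l) w =
      x w \<bullet> (ddP j k w *v x w) - partial_deriv j l w * (x w \<bullet> (dQ k w *v x w))
      - l w * (x w \<bullet> (ddQ j k w *v x w))
      + 2 * (partial_deriv j x w \<bullet> (dP k w *v x w) - l w * (partial_deriv j x w \<bullet> (dQ k w *v x w)))"
    (is "_ = ?r")
proof -
  note D = has_vector_derivative_partial_deriv[OF smooth_on_differentiable \<open>open W\<close> w(1), of _ j]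
  note l = D[OF W(2)] and x = D[OF W(3)]
  have quad: "((\<lambda>t. x (w + t *\<^sub>R axis j 1) \<bullet> (F (w + t *\<^sub>R axis j 1) *v x (w + t *\<^sub>R axis j 1)))
      has_vector_derivative x w \<bullet> (F' *v x w) + 2 * (partial_deriv j x w \<bullet> (F w *v x w))) (at 0)"
    if "((\<lambda>t. F (w + t *\<^sub>R axis j 1)) has_vector_derivative F') (at 0)" "symmetric_mat (F w)" for F F'
    using has_vector_derivative_inner[OF x has_vector_derivative_matrix_vector[OF that(1) x]]
      symmetric_mat_inner[OF that(2), of "x w" "partial_deriv j x w"]
    by (simp add: inner_add_right inner_commute algebra_simps)
  have "((\<lambda>t. (\<lambda>w. x w \<bullet> (dP k w *v x w) - l w * (x w \<bullet> (dQ k w *v x w))) (w + t *\<^sub>R axis j 1))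
      has_vector_derivative ?r) (at 0)"
    using has_vector_derivative_diff[OF quad[OF ddP[OF w(2)] sym_derivative(1)[OF w(2)]]
        bounded_bilinear.has_vector_derivative[OF bounded_bilinear_mult l
          quad[OF ddQ[OF w(2)] sym_derivative(2)[OF w(2)]]]]
    by (simp add: algebra_simps)
  \<comment> \<open>The first-order formula holds on a whole neighbourhood of \<open>w\<close>, so
    it may replace \<open>partial_deriv k l\<close> under the derivative.\<close>
  then have "((\<lambda>t. partial_deriv k l (w + t *\<^sub>R axis j 1)) has_vector_derivative ?r) (at 0)"
    by (rule has_vector_derivative_transform_within_open[OF _
          open_line_preimage[OF open_Int[OF \<open>open W\<close> open_U], of w j]])
      (use w first_order(2)[OF W eig] in auto)
  then show ?thesis
    unfolding partial_deriv_def[of j "partial_deriv k l"] by (rule vector_derivative_at)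
qed

text \<open>For fixed \<open>V\<close> the map \<open>reduced_mat V\<close> is linear, so it
  commutes with all derivatives.\<close>

lemma reduced:
  fixes V :: "real ^ 'm ^ 'n"
  shows "smooth_pencil U (\<lambda>w. reduced_mat V (P w)) (\<lambda>w. reduced_mat V (Q w))
    (\<lambda>k w. reduced_mat V (dP k w)) (\<lambda>k w. reduced_mat V (dQ k w))
    (\<lambda>j k w. reduced_mat V (ddP j k w)) (\<lambda>j k w. reduced_mat V (ddQ j k w))"
proof -
  have "linear (reduced_mat V :: real ^ 'n ^ 'n \<Rightarrow> real ^ 'm ^ 'm)"
    by (intro linearI) (simp_all add: matrix_eq reduced_mat_mult matrix_vector_mult_add_rdistrib
        matrix_vector_right_distrib matrix_vector_mult_scaleR flip: scaleR_matrix_vector_assoc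
        del: transpose_matrix_vector)
  then have bl: "bounded_linear (reduced_mat V :: real ^ 'n ^ 'n \<Rightarrow> real ^ 'm ^ 'm)"
    by (rule linear_conv_bounded_linear[THEN iffD1])
  have *: "((\<lambda>t. reduced_mat V (f t)) has_vector_derivative reduced_mat V f') F"
    if "(f has_vector_derivative f') F" for f f' and F :: "real filter"
    using that by (rule bounded_linear.has_vector_derivative[OF bl])
  show ?thesis
    by unfold_locales (auto intro: open_U sym symmetric_mat_reduced * dP dQ ddP ddQ)
qed

lemma Hermite_interpolation:
  fixes V :: "real ^ 'm ^ 'n"
  assumes V: "orthonormal_basis_of V S" "x0 \<in> S" and w: "w \<in> U"
    and full: "smooth_eigenpair_at P Q w l0 x0 l x"
    and red: "smooth_eigenpair_at (\<lambda>w. reduced_mat V (P w)) (\<lambda>w. reduced_mat V (Q w)) w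
       l0 (transpose V *v x0) lV xV"
  shows "partial_deriv j lV w = partial_deriv j l w"
    and "partial_deriv j x w \<in> S \<Longrightarrow>
       partial_deriv j (partial_deriv k lV) w = partial_deriv j (partial_deriv k l) w"
proof -
  interpret R: smooth_pencil U "\<lambda>w. reduced_mat V (P w)" "\<lambda>w. reduced_mat V (Q w)"
    "\<lambda>k w. reduced_mat V (dP k w)" "\<lambda>k w. reduced_mat V (dQ k w)"
    "\<lambda>j k w. reduced_mat V (ddP j k w)" "\<lambda>j k w. reduced_mat V (ddQ j k w)"
    by (rule reduced)
  obtain W where W: "open W" "smooth_on l W" "smooth_on x W"
    "\<And>w. w \<in> W \<Longrightarrow> normalised_eigenpair (P w) (Q w) (l w) (x w)" "w \<in> W"
    and at: "l w = l0" "x w = x0"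
    using full unfolding smooth_eigenpair_at_def by blast
  obtain W' where W': "open W'" "smooth_on lV W'" "smooth_on xV W'"
    "\<And>w. w \<in> W' \<Longrightarrow> normalised_eigenpair (reduced_mat V (P w)) (reduced_mat V (Q w)) (lV w) (xV w)"
    "w \<in> W'"
    and at': "lV w = l0" "xV w = transpose V *v x0"
    using red unfolding smooth_eigenpair_at_def by blast
  have x0: "V *v (xV w) = x0"
    unfolding at' by (rule orthonormal_basis_of_projection[OF V])
  \<comment> \<open>After rewriting, both sets of formulas live in the full space with the same
    eigenvalue \<open>l0\<close> and the same vector \<open>x0\<close>; only the derivatives of the
    eigenpairs can differ.\<close>
  note F1 = first_order[OF W w, unfolded at]
  note R1 = R.first_order[OF W' w, unfolded inner_reduced_mat x0 at'(1)]
  show eq: "partial_deriv j lV w = partial_deriv j l w" for j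
    using F1(2) R1(2) by simp
  assume "partial_deriv j x w \<in> S"
  then obtain z where z: "partial_deriv j x w = V *v z"
    using orthonormal_basis_of_range[OF V(1)] by auto
  define u where "u = partial_deriv j xV w - z"
  have Vu: "V *v partial_deriv j xV w = V *v z + V *v u"
    by (simp add: u_def matrix_vector_mult_diff_distrib)
  let ?y = "V *v partial_deriv k xV w"
  \<comment> \<open>Subtracting the two linearised equations in direction \<open>j\<close> cancels
    all inhomogeneous terms, by equality of the first derivatives. The test vector \<open>?y\<close>
    is the one met again in direction \<open>k\<close>.\<close>
  have "?y \<bullet> (P w *v (V *v u)) = l0 * (?y \<bullet> (Q w *v (V *v u)))"
    using F1(1)[of ?y j] R1(1)[of "partial_deriv k xV w" j]
    by (simp add: eq Vu z matrix_vector_right_distrib inner_add_right algebra_simps)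
  then have "(V *v u) \<bullet> (P w *v ?y) = l0 * ((V *v u) \<bullet> (Q w *v ?y))"
    using symmetric_mat_inner[OF sym(1)[OF w], of ?y "V *v u"]
      symmetric_mat_inner[OF sym(2)[OF w], of ?y "V *v u"] by (simp add: inner_commute)
  \<comment> \<open>Both normalisations prescribe the same value for the \<open>Q\<close>-product of
    the eigenvector derivative with \<open>x0\<close>.\<close>
  moreover have "(V *v u) \<bullet> (Q w *v x0) = 0"
    using F1(3)[of j] R1(3)[of j] by (simp add: Vu z inner_add_left)
  \<comment> \<open>The reduced linearised equation in direction \<open>k\<close>, tested with
    \<open>u\<close>: the two preceding facts remove every other term.\<close>
  ultimately have "(V *v u) \<bullet> (dP k w *v x0) = l0 * ((V *v u) \<bullet> (dQ k w *v x0))"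
    using R1(1)[of u k] by simp
  \<comment> \<open>The two second-order formulas differ by exactly twice the difference of the
    sides just equated.\<close>
  then show "partial_deriv j (partial_deriv k lV) w = partial_deriv j (partial_deriv k l) w"
    using second_order[OF W w, of j k] R.second_order[OF W' w, of j k]
    by (simp add: inner_reduced_mat orthonormal_basis_of_projection[OF V] at at' Vu z eq inner_add_left algebra_simps del: transpose_matrix_vector)
qed

end

text \<open>\<open>U\<close> gives room for partial derivatives at boundary points of
  \<open>\<Omega>\<close>. Dimensions of subspaces are the cardinalities of the nonempty types
  \<open>'m\<close>, \<open>'m1\<close>, \<open>'m2\<close>, so the subspaces are nonzero and the
  reduced minimal eigenvalues make sense.\<close>

theorem mainTheorem1:
  fixes \<Omega> U :: "(real ^ 'd) set"
    and A B :: "real ^ 'd \<Rightarrow> real ^ 'n ^ 'n"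
  assumes "compact \<Omega>"
    and "open U" and "\<Omega> \<subseteq> U"
    and "real_analytic_on A U" and "real_analytic_on B U"
    and "\<forall>\<omega>\<in>U. symmetric_mat (A \<omega>) \<and> symmetric_mat (B \<omega>)"
    and "\<forall>\<omega>\<in>\<Omega>. pos_def_mat (B \<omega>)"
  shows
    "(\<forall>\<omega>s\<in>\<Omega>. \<forall>ls xs. \<forall>\<V>. \<forall>V :: real ^ 'm ^ 'n.
        normalised_eigenpair (A \<omega>s) (B \<omega>s) ls xs \<and> simple_eigenvalue (A \<omega>s) (B \<omega>s) ls \<and>
        orthonormal_basis_of V \<V> \<and> xs \<in> \<V> \<longrightarrow>
          normalised_eigenpair (reduced_mat V (A \<omega>s)) (reduced_mat V (B \<omega>s)) ls (transpose V *v xs) \<and>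
          (\<forall>l x lV xV.
             smooth_eigenpair_at A B \<omega>s ls xs l x \<and>
             smooth_eigenpair_at (\<lambda>\<omega>. reduced_mat V (A \<omega>)) (\<lambda>\<omega>. reduced_mat V (B \<omega>)) \<omega>s
               ls (transpose V *v xs) lV xV \<longrightarrow>
               (\<forall>j. partial_deriv j lV \<omega>s = partial_deriv j l \<omega>s) \<and>
               (\<forall>j. partial_deriv j x \<omega>s \<in> \<V> \<longrightarrow>
                  (\<forall>k. partial_deriv j (partial_deriv k lV) \<omega>s =
                       partial_deriv j (partial_deriv k l) \<omega>s))))
     \<and>
     (\<forall>\<V>1 \<V>2. \<forall>V1 :: real ^ 'm1 ^ 'n. \<forall>V2 :: real ^ 'm2 ^ 'n.
        orthonormal_basis_of V1 \<V>1 \<and> orthonormal_basis_of V2 \<V>2 \<and> \<V>1 \<subseteq> \<V>2 \<longrightarrow>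
          (\<forall>\<omega>\<in>\<Omega>.
             min_eigenvalue (A \<omega>) (B \<omega>)
               \<le> min_eigenvalue (reduced_mat V2 (A \<omega>)) (reduced_mat V2 (B \<omega>)) \<and>
             min_eigenvalue (reduced_mat V2 (A \<omega>)) (reduced_mat V2 (B \<omega>))
               \<le> min_eigenvalue (reduced_mat V1 (A \<omega>)) (reduced_mat V1 (B \<omega>))))"
proof -
  have ana: "real_analytic_on (\<lambda>w. F w \<bullet> b) U" if "real_analytic_on F U"
    for F :: "real ^ 'd \<Rightarrow> real ^ 'n ^ 'n" and b
    using that real_analytic_at_bounded_linear[OF bounded_linear_inner_left]
    by (auto simp: real_analytic_on_def)
  obtain dA where dA:
    "\<And>k w. w \<in> U \<Longrightarrow> ((\<lambda>t. A (w + t *\<^sub>R axis k 1)) has_vector_derivative dA k w) (at 0)"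
    "\<And>k b. b \<in> Basis \<Longrightarrow> real_analytic_on (\<lambda>w. dA k w \<bullet> b) U"
    using real_analytic_on_partial_field[OF ana[OF assms(4)]] by metis
  obtain dB where dB:
    "\<And>k w. w \<in> U \<Longrightarrow> ((\<lambda>t. B (w + t *\<^sub>R axis k 1)) has_vector_derivative dB k w) (at 0)"
    "\<And>k b. b \<in> Basis \<Longrightarrow> real_analytic_on (\<lambda>w. dB k w \<bullet> b) U"
    using real_analytic_on_partial_field[OF ana[OF assms(5)]] by metis
  have "\<exists>ddA. \<forall>j. \<forall>w\<in>U. ((\<lambda>t. dA k (w + t *\<^sub>R axis j 1)) has_vector_derivative ddA j w) (at 0)" for k
    using real_analytic_on_partial_field[OF dA(2)[of _ k]] by metis
  then obtain ddA where ddA: "\<And>j k w. w \<in> U \<Longrightarrow>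
      ((\<lambda>t. dA k (w + t *\<^sub>R axis j 1)) has_vector_derivative ddA k j w) (at 0)"
    by metis
  have "\<exists>ddB. \<forall>j. \<forall>w\<in>U. ((\<lambda>t. dB k (w + t *\<^sub>R axis j 1)) has_vector_derivative ddB j w) (at 0)" for k
    using real_analytic_on_partial_field[OF dB(2)[of _ k]] by metis
  then obtain ddB where ddB: "\<And>j k w. w \<in> U \<Longrightarrow>
      ((\<lambda>t. dB k (w + t *\<^sub>R axis j 1)) has_vector_derivative ddB k j w) (at 0)"
    by metis
  have sym: "symmetric_mat (A w)" "symmetric_mat (B w)" if "w \<in> U" for w
    using assms(6) that by auto
  \<comment> \<open>The arguments are swapped because \<open>ddA k j\<close> arose by
    differentiating \<open>dA k\<close> in direction \<open>j\<close>.\<close>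
  interpret smooth_pencil U A B dA dB "\<lambda>j k. ddA k j" "\<lambda>j k. ddB k j"
    by unfold_locales (auto intro: assms(2) sym dA(1) dB(1) ddA ddB)
  have mono: "min_eigenvalue (A w) (B w) \<le> min_eigenvalue (reduced_mat V2 (A w)) (reduced_mat V2 (B w)) \<and>
      min_eigenvalue (reduced_mat V2 (A w)) (reduced_mat V2 (B w))
        \<le> min_eigenvalue (reduced_mat V1 (A w)) (reduced_mat V1 (B w))"
    if "w \<in> \<Omega>" "orthonormal_basis_of V1 S1" "orthonormal_basis_of V2 S2" "S1 \<subseteq> S2"
    for w S1 S2 and V1 :: "real ^ 'm1 ^ 'n" and V2 :: "real ^ 'm2 ^ 'n"
  proof -
    have "w \<in> U" "pos_def_mat (B w)"
      using that(1) assms(3,7) by auto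
    note M = sym[OF this(1)] this(2)
    \<comment> \<open>The lower bound by the full pencil is the first comparison with
      \<open>V2\<close> in both roles.\<close>
    show ?thesis
      using min_eigenvalue_reduced_mono(1)[OF M that(3,3) order_refl]
        min_eigenvalue_reduced_mono(2)[OF M that(2,3,4)] by blast
  qed
  show ?thesis
  proof (intro conjI allI ballI impI; (elim conjE)?)
    fix w ls xs \<V> and V :: "real ^ 'm ^ 'n"
    assume w: "w \<in> \<Omega>" and eig: "normalised_eigenpair (A w) (B w) ls xs"
      and V: "orthonormal_basis_of V \<V>" "xs \<in> \<V>"
    show "normalised_eigenpair (reduced_mat V (A w)) (reduced_mat V (B w)) ls (transpose V *v xs)"
      by (rule normalised_eigenpair_reduced[OF eig V])
    have "w \<in> U" using w assms(3) by blast
    note H = Hermite_interpolation[OF V this]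
    fix l x lV xV j
    assume "smooth_eigenpair_at A B w ls xs l x"
      and "smooth_eigenpair_at (\<lambda>w. reduced_mat V (A w)) (\<lambda>w. reduced_mat V (B w)) w
        ls (transpose V *v xs) lV xV"
    note H' = H[OF this]
    show "partial_deriv j lV w = partial_deriv j l w"
      by (rule H'(1))
    show "partial_deriv j (partial_deriv k lV) w = partial_deriv j (partial_deriv k l) w"
      if "partial_deriv j x w \<in> \<V>" for k
      using that by (rule H'(2))
  qed (use mono in blast)+
qed

end
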